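(* Let $n$ be a positive integer. Let $W(n)$ be the set of positive divisors $w$ of $n$ such that (i) $p \mid w$ for every prime $p$ dividing $n$, and (ii) if $4 \mid n$ then $4 \mid w$. Then the isomorphism classes of bicyclic braces of order $n$ correspond bijectively with the elements of $W(n)$, the bicyclic brace corresponding to $w \in W(n)$ being realized by $(\mathbb{Z}_n, +, \circ_w)$, where $+$ is the usual addition on $\mathbb{Z}_n$ and $x \circ_w y = x + y + wxy$. (That is: for each $w\in W(n)$ the triple $(\mathbb{Z}_n,+,\circ_w)$ is a bicyclic brace, and every bicyclic brace of order $n$ is isomorphic to $(\mathbb{Z}_n,+,\circ_w)$ for exactly one $w \in W(n)$.) Moreover, for $w \in W(n)$, the bicyclic brace $(\mathbb{Z}_n, +, \circ_w)$ is biskew if and only if $n \mid w^2$.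
   Context: $\mathbb{Z}_n = \mathbb{Z}/n\mathbb{Z}$. A (left) skew brace is a triple $(B,+,\circ)$ in which $(B,+)$ and $(B,\circ)$ are groups (not assumed abelian) and $x \circ (y+z) = (x\circ y) - x + (x \circ z)$ for all $x,y,z \in B$, where $-x$ is the inverse of $x$ in $(B,+)$. A brace is a skew brace with $(B,+)$ abelian. $(B,+)$ is the additive group and $(B,\circ)$ the multiplicative group. The order of a (skew) brace is the cardinality of $B$. An isomorphism of skew braces is a bijection between the underlying sets respecting both operations. A bicyclic brace is a finite brace whose additive and multiplicative groups are both cyclic. A skew brace $(B,+,\circ)$ is biskew if $(B,\circ,+)$ is also a skew brace. *)

theory Defs
  imports "HOL-Algebra.Elementary_Groups" "HOL-Computational_Algebra.Primes"
begin

text \<open>A skew brace \<open>(B,+,\<circ>)\<close> is given by its additive group \<open>A\<close> and its multiplicative group \<open>M\<close>,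
  two group records with the same carrier \<open>B\<close>. Since HOL-Algebra writes every group
  multiplicatively, \<open>x \<otimes>\<^bsub>A\<^esub> y\<close> stands for \<open>x + y\<close>, \<open>inv\<^bsub>A\<^esub> x\<close> for \<open>-x\<close> and
  \<open>x \<otimes>\<^bsub>M\<^esub> y\<close> for \<open>x \<circ> y\<close>.\<close>

locale skew_brace = additive: group A + multiplicative: group M
  for A :: "('a, 'b) monoid_scheme" and M :: "('a, 'c) monoid_scheme" +
  assumes carrier_eq: "carrier M = carrier A"
    and brace_distrib:
      "\<lbrakk>x \<in> carrier A; y \<in> carrier A; z \<in> carrier A\<rbrakk> \<Longrightarrow>
        x \<otimes>\<^bsub>M\<^esub> (y \<otimes>\<^bsub>A\<^esub> z) = (x \<otimes>\<^bsub>M\<^esub> y) \<otimes>\<^bsub>A\<^esub> inv\<^bsub>A\<^esub> x \<otimes>\<^bsub>A\<^esub> (x \<otimes>\<^bsub>M\<^esub> z)"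

definition brace :: "('a, 'b) monoid_scheme \<Rightarrow> ('a, 'c) monoid_scheme \<Rightarrow> bool"
  where "brace A M \<longleftrightarrow> skew_brace A M \<and> comm_group A"

definition bicyclic_brace :: "('a, 'b) monoid_scheme \<Rightarrow> ('a, 'c) monoid_scheme \<Rightarrow> bool"
  where "bicyclic_brace A M \<longleftrightarrow>
    brace A M \<and> finite (carrier A) \<and> cyclic_group A \<and> cyclic_group M"

definition biskew :: "('a, 'b) monoid_scheme \<Rightarrow> ('a, 'c) monoid_scheme \<Rightarrow> bool"
  where "biskew A M \<longleftrightarrow> skew_brace A M \<and> skew_brace M A"

definition skew_brace_isomorphic ::
  "('a, 'b) monoid_scheme \<Rightarrow> ('a, 'c) monoid_scheme \<Rightarrow>
   ('d, 'e) monoid_scheme \<Rightarrow> ('d, 'f) monoid_scheme \<Rightarrow> bool"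
  where "skew_brace_isomorphic A M A' M' \<longleftrightarrow> (\<exists>f. f \<in> iso A A' \<and> f \<in> iso M M')"

definition W :: "nat \<Rightarrow> nat set"
  where "W n = {w. w dvd n \<and> (\<forall>p. prime p \<and> p dvd n \<longrightarrow> p dvd w) \<and> (4 dvd n \<longrightarrow> 4 dvd w)}"

text \<open>\<open>(\<int>\<^sub>n, \<circ>\<^sub>w)\<close> on the representatives \<open>0, \<dots>, n - 1\<close> used by \<^const>\<open>integer_mod_group\<close>, which
  serves as \<open>(\<int>\<^sub>n, +)\<close>. The unit \<open>0\<close> is inherited from the latter.\<close>

definition circ_group :: "nat \<Rightarrow> nat \<Rightarrow> int monoid"
  where "circ_group n w =
    (integer_mod_group n)\<lparr>monoid.mult := \<lambda>x y. (x + y + int w * x * y) mod int n\<rparr>"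

end

theory Submission
  imports Defs "HOL-Number_Theory.Cong" "HOL-Algebra.Multiplicative_Group"
begin

text \<open>In a bicyclic brace let \<open>c\<close> generate the multiplicative group. The map \<open>y \<mapsto> -c + c \<circ> y\<close> is an
  endomorphism of a cyclic group, hence multiplication by some \<open>u\<close>, and the \<open>k\<close>-th multiplicative
  power of \<open>c\<close> is \<open>(1 + u + \<dots> + u ^ (k - 1)) c\<close>. So \<open>c\<close> generates the additive group as well, and
  in the coordinate \<open>i \<mapsto> i c\<close> the product reads \<open>i + j + v i j\<close> with \<open>v = u - 1\<close>. Rescaling by a
  unit replaces \<open>v\<close> by \<open>w = gcd v n\<close>. Left cancellation forces every prime divisor of \<open>n\<close> to divide
  \<open>v\<close>, and if \<open>4\<close> divides \<open>n\<close> but \<open>v\<close> is \<open>2\<close> modulo \<open>4\<close>, the powers of \<open>c\<close> miss \<open>2 c\<close>.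
  Conversely, for \<open>w \<in> W n\<close> the element \<open>1\<close> generates \<open>(\<int>\<^sub>n, \<circ>\<^sub>w)\<close>, because
  \<open>1 + u + \<dots> + u ^ (m - 1)\<close> with \<open>u = 1 + w\<close> is divisible by \<open>n\<close> only if \<open>m\<close> is (one prime factor
  of \<open>m\<close> is split off at a time). Finally, the defect of the second brace law is
  \<open>w\<^sup>2 x y z\<close> up to a unit.\<close>

section \<open>Geometric sums modulo \<open>n\<close>\<close>

lemma geometric_sum_Suc:
  fixes u :: "'a :: comm_semiring_1"
  shows "(\<Sum>i<Suc k. u ^ i) = 1 + u * (\<Sum>i<k. u ^ i)"
  by (simp only: sum.lessThan_Suc_shift) (simp add: sum_distrib_left)

lemma geometric_sum_add:
  fixes u :: "'a :: comm_semiring_1"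
  shows "(\<Sum>i<a + b. u ^ i) = (\<Sum>i<a. u ^ i) + u ^ a * (\<Sum>i<b. u ^ i)"
  by (induction b) (simp_all add: algebra_simps power_add)

text \<open>The exponents below \<open>a * b\<close> fall into \<open>b\<close> blocks of length
  \<open>a\<close>; each block is a power of \<open>u ^ a\<close> times the first one.\<close>

lemma geometric_sum_mult:
  fixes u :: "'a :: comm_semiring_1"
  shows "(\<Sum>i<a * b. u ^ i) = (\<Sum>i<a. u ^ i) * (\<Sum>i<b. (u ^ a) ^ i)"
proof (induction b)
  case (Suc b)
  then show ?case
    using geometric_sum_add[of u "a * b" a] by (simp add: algebra_simps power_mult)
qed simp

text \<open>Binomial expansion cut off after the linear term.\<close>

lemma dvd_power_minus_linear:
  fixes P t :: int
  shows "P\<^sup>2 dvd (1 + P * t) ^ i - 1 - P * t * int i"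
proof (induction i)
  case (Suc i)
  have "(1 + P * t) ^ Suc i - 1 - P * t * int (Suc i) =
      (1 + P * t) * ((1 + P * t) ^ i - 1 - P * t * int i) + P\<^sup>2 * (t\<^sup>2 * int i)"
    by (simp add: algebra_simps power2_eq_square)
  then show ?case
    using Suc by (metis dvd_add dvd_mult dvd_triv_left)
qed simp

lemma dvd_geometric_sum_minus:
  fixes u :: int
  assumes "d dvd u - 1"
  shows "d dvd (\<Sum>i<m. u ^ i) - int m"
proof (induction m)
  case (Suc m)
  have "d dvd u ^ m - 1"
    using assms by (metis dvd_trans dvd_triv_left power_diff_1_eq)
  then have "d dvd ((\<Sum>i<m. u ^ i) - int m) + (u ^ m - 1)"
    using Suc by (rule dvd_add[rotated])
  then show ?case
    by (simp add: algebra_simps)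
qed simp

text \<open>Modulo \<open>p\<^sup>2\<close> the sum is \<open>p\<close>, so exactly one factor
  \<open>p\<close> comes out. For odd \<open>p\<close> the linear terms of the powers add up to
  \<open>p t\<close> times \<open>p (p - 1) / 2\<close>, a multiple of \<open>p\<^sup>2\<close>. For
  \<open>p = 2\<close> the sum is \<open>2 + (u - 1)\<close>, whence the condition modulo 4.\<close>

lemma geometric_sum_prime:
  fixes u :: int
  assumes p: "prime p" and u: "int p dvd u - 1" "p = 2 \<Longrightarrow> 4 dvd u - 1"
  obtains r where "(\<Sum>i<p. u ^ i) = int p * r" "coprime r (int p)"
proof -
  have "(int p)\<^sup>2 dvd (\<Sum>i<p. u ^ i) - int p"
  proof (cases "p = 2")
    case True
    then show ?thesis
      using u(2) by (simp add: numeral_2_eq_2)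
  next
    case False
    obtain t where "u - 1 = int p * t"
      using u(1) by blast
    then have t: "u = 1 + int p * t"
      by simp
    have "odd p"
      using p False primes_dvd_imp_eq two_is_prime_nat by blast
    then obtain q where q: "p = 2 * q + 1"
      by (elim oddE)
    have "2 * (\<Sum>i<k. int i) = int k * (int k - 1)" for k
      by (induction k) (auto simp: algebra_simps)
    from this[of p] have "(\<Sum>i<p. int i) = int p * int q"
      using q by simp
    then have "(\<Sum>i<p. u ^ i) - int p = (\<Sum>i<p. u ^ i - 1 - int p * t * int i) + (int p)\<^sup>2 * (t * int q)"
      by (simp add: sum_subtractf power2_eq_square flip: sum_distrib_left)
    moreover have "(int p)\<^sup>2 dvd (\<Sum>i<p. u ^ i - 1 - int p * t * int i)"
      unfolding t by (intro dvd_sum dvd_power_minus_linear)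
    ultimately show ?thesis
      by simp
  qed
  then obtain s where s: "(\<Sum>i<p. u ^ i) - int p = (int p)\<^sup>2 * s"
    by blast
  show thesis
  proof
    show "(\<Sum>i<p. u ^ i) = int p * (1 + int p * s)"
      using s by (simp add: algebra_simps power2_eq_square)
    show "coprime (1 + int p * s) (int p)"
      by (metis add.commute coprime_1_left coprime_iff_gcd_eq_1 gcd_add_mult mult.commute gcd.commute)
  qed
qed

text \<open>Lifting the exponent by induction on \<open>k\<close>: modulo \<open>p\<close> the sum
  is \<open>m\<close>, so \<open>m = p * m'\<close>. The first block of length \<open>p\<close>
  absorbs exactly one factor \<open>p\<close>, and the remaining factor is the sum for
  \<open>u ^ p\<close> and \<open>m'\<close>.\<close>

lemma prime_power_dvd_geometric_sum_imp_dvd: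
  fixes u :: int
  assumes p: "prime p" and "int p dvd u - 1" "p = 2 \<Longrightarrow> k \<ge> 2 \<Longrightarrow> 4 dvd u - 1"
    and "int p ^ k dvd (\<Sum>i<m. u ^ i)"
  shows "p ^ k dvd m"
  using assms(2-)
proof (induction k arbitrary: u m)
  case (Suc k)
  have "int p dvd (\<Sum>i<m. u ^ i)"
    using Suc.prems(3) by (metis dvd_mult_left power_Suc)
  then have "int p dvd int m"
    using dvd_geometric_sum_minus[OF Suc.prems(1), of m] by (simp add: dvd_diff_right_iff)
  then obtain m' where m: "m = p * m'"
    by auto
  \<comment> \<open>Exponent one is settled by \<open>m = p * m'\<close> alone; the congruence
    modulo 4 is guaranteed only from exponent two on.\<close>
  show ?case
  proof (cases "k = 0")
    case False
    then have "p = 2 \<Longrightarrow> 4 dvd u - 1"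
      using Suc.prems(2) by simp
    then obtain r where r: "(\<Sum>i<p. u ^ i) = int p * r" "coprime r (int p)"
      using geometric_sum_prime[OF p Suc.prems(1)] by blast
    have dvd: "u - 1 dvd u ^ p - 1"
      by (metis dvd_triv_left power_diff_1_eq)
    have "int p * int p ^ k dvd int p * (r * (\<Sum>i<m'. (u ^ p) ^ i))"
      using Suc.prems(3) r(1) unfolding m geometric_sum_mult by (simp add: mult.assoc)
    then have "int p ^ k dvd r * (\<Sum>i<m'. (u ^ p) ^ i)"
      using p by (simp add: prime_gt_0_nat)
    then have "int p ^ k dvd (\<Sum>i<m'. (u ^ p) ^ i)"
      using r(2) by (metis coprime_commute coprime_dvd_mult_right_iff coprime_power_left_iff)
    then have "p ^ k dvd m'"
      using Suc.IH[of "u ^ p" m'] Suc.prems dvd dvd_trans by (metis le_SucI)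
    then show ?thesis
      using m by simp
  qed (use m in simp)
qed simp

text \<open>The criterion is applied to the full power of each prime in \<open>n\<close>. Its
  hypotheses on \<open>u = 1 + w\<close> are the two conditions in \<open>W n\<close>; the one
  modulo 4 is asked only when 4 divides \<open>n\<close>.\<close>

lemma dvd_geometric_sum_imp_dvd:
  assumes w: "w \<in> W n" and n: "n > 0" and dvd: "int n dvd (\<Sum>i<m. (1 + int w) ^ i)"
  shows "n dvd m"
proof (cases "m = 0")
  case False
  show ?thesis
  proof (rule multiplicity_le_imp_dvd)
    fix p :: nat
    assume p: "prime p"
    define k where "k = multiplicity p n"
    have k: "p ^ k dvd n"
      by (simp add: k_def multiplicity_dvd)
    have "p ^ k dvd m"
    proof (cases "k = 0")
      case False
      then have "p dvd n"
        using k by (metis dvd_power dvd_trans gr0I)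
      then have "int p dvd 1 + int w - 1"
        using w p by (simp add: W_def)
      moreover have "4 dvd 1 + int w - 1" if "p = 2" "k \<ge> 2"
      proof -
        have "4 dvd n"
          using k dvd_trans[OF le_imp_power_dvd[OF that(2), of p]] that(1) by simp
        then have "4 dvd w"
          using w by (simp add: W_def)
        then show ?thesis
          by presburger
      qed
      moreover have "int p ^ k dvd (\<Sum>i<m. (1 + int w) ^ i)"
        using k dvd by (metis dvd_trans of_nat_dvd_iff of_nat_power)
      ultimately show ?thesis
        using prime_power_dvd_geometric_sum_imp_dvd[OF p] by blast
    qed simp
    then show "multiplicity p n \<le> multiplicity p m"
      using False p by (metis k_def multiplicity_geI not_prime_unit)
  qed (use n in simp)
qed simp

section \<open>Units modulo \<open>n\<close>\<close>

lemma coprime_if_no_common_prime: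
  fixes a b :: "'a :: factorial_semiring_gcd"
  assumes "b \<noteq> 0" and "\<And>q. prime q \<Longrightarrow> q dvd a \<Longrightarrow> q dvd b \<Longrightarrow> False"
  shows "coprime a b"
proof (rule ccontr)
  assume "\<not> coprime a b"
  then have "\<not> is_unit (gcd a b)"
    using is_unit_gcd by blast
  then obtain q where "q dvd gcd a b" "prime q"
    using prime_divisor_exists[of "gcd a b"] assms(1) by auto
  then show False
    using assms(2) by auto
qed

text \<open>A unit modulo \<open>m\<close> can be shifted to a unit modulo \<open>n\<close>. With
  \<open>j\<close> the product of the primes of \<open>n\<close> that do not divide
  \<open>a\<close>, every prime of \<open>n\<close> divides exactly one of \<open>a\<close> and
  \<open>m * j\<close>.\<close>

lemma coprime_add_mult_exists:
  fixes a m :: int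
  assumes "coprime a m" and n: "n > 0"
  obtains j where "coprime (a + m * j) (int n)"
proof
  let ?P = "{p \<in> prime_factors n. \<not> int p dvd a}"
  let ?j = "\<Prod>p\<in>?P. int p"
  show "coprime (a + m * ?j) (int n)"
  proof (rule coprime_if_no_common_prime)
    fix q :: int
    assume q: "prime q" "q dvd a + m * ?j" "q dvd int n"
    obtain p where qp: "q = int p"
      using q(1) prime_ge_0_int zero_le_imp_eq_int by metis
    then have p: "prime p" "q = int p" "p dvd n"
      using q by simp_all
    have P: "int p dvd ?j \<longleftrightarrow> \<not> int p dvd a"
      using p n by (auto simp: prime_dvd_prod_iff in_prime_factors_iff dest: primes_dvd_imp_eq)
    show False
    proof (cases "int p dvd a")
      case True
      then have "int p dvd m * ?j"
        using q(2) p(2) dvd_add_right_iff by blast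
      then have "int p dvd m"
        using P True prime_dvd_mult_iff[OF q(1)[unfolded p(2)]] by simp
      then show False
        using True assms(1) q(1) p(2) by (metis coprime_common_divisor not_prime_unit)
    next
      case False
      then have "int p dvd m * ?j"
        using P by simp
      then show False
        using q(2) p(2) False dvd_add_left_iff by blast
    qed
  qed (use n in simp)
qed

text \<open>Bezout yields a factor \<open>a\<close> that is a unit only modulo
  \<open>n' = n / g\<close>. Adding a multiple of \<open>n'\<close> makes it a unit modulo
  \<open>n\<close> and does not change \<open>v * a\<close> modulo \<open>n\<close>, because
  \<open>n\<close> divides \<open>v * n'\<close>.\<close>

lemma unit_multiple_eq_gcd:
  fixes v :: int
  assumes n: "n > 0"
  obtains s where "coprime s (int n)" "[v * s = gcd v (int n)] (mod int n)"
proof -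
  define g where "g = gcd v (int n)"
  have "g > 0"
    using n by (simp add: g_def)
  obtain a b where ab: "a * v + b * int n = g"
    using bezout_int g_def by metis
  obtain v' n' where v': "v = g * v'" and n': "int n = g * n'"
    by (metis g_def dvdE gcd_dvd1 gcd_dvd2)
  have "g * (a * v' + b * n') = g * 1"
    using ab v' n' by (simp add: algebra_simps)
  then have eq: "a * v' + b * n' = 1"
    using \<open>g > 0\<close> by simp
  then have "coprime a n'"
    by (metis coprimeI dvd_add dvd_mult2 dvd_mult)
  then obtain j where j: "coprime (a + n' * j) (int n)"
    using coprime_add_mult_exists n by blast
  have "v * (a + n' * j) - g = int n * (v' * j - b)"
    using ab v' n' by (simp add: algebra_simps)
  then show thesis
    using that[OF j] by (simp add: g_def cong_iff_dvd_diff)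
qed

text \<open>Every prime divisor of \<open>n\<close> divides \<open>w\<close>, so
  \<open>1 + w x\<close> is 1 modulo it.\<close>

lemma coprime_one_plus_mult_W:
  assumes "w \<in> W n" "n > 0"
  shows "coprime (1 + int w * x) (int n)"
proof (rule coprime_if_no_common_prime)
  fix q :: int
  assume q: "prime q" "q dvd 1 + int w * x" "q dvd int n"
  obtain p where p: "q = int p"
    using q(1) prime_ge_0_int zero_le_imp_eq_int by metis
  have "q dvd int w"
    using assms(1) q p by (simp add: W_def)
  then have "q dvd 1"
    using q(2) by (metis dvd_add_left_iff dvd_mult2)
  then show False
    using q(1) not_prime_unit by blast
qed (use assms in simp)

lemma mult_W_inverse:
  assumes "w \<in> W n" "n > 0"
  obtains s where "[(1 + int w * x) * s = 1] (mod int n)"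
  using cong_solve_coprime_int[OF coprime_one_plus_mult_W[OF assms]] by blast

section \<open>The braces \<open>(\<int>\<^sub>n, +, \<circ>\<^sub>w)\<close>\<close>

lemma circ_group_simps [simp]:
  "carrier (circ_group n w) = carrier (integer_mod_group n)"
  "\<one>\<^bsub>circ_group n w\<^esub> = 0"
  "x \<otimes>\<^bsub>circ_group n w\<^esub> y = (x + y + int w * x * y) mod int n"
  by (simp_all add: circ_group_def integer_mod_group_def)

lemma mod_in_integer_mod_group: "n > 0 \<Longrightarrow> x mod int n \<in> carrier (integer_mod_group n)"
  by (simp add: carrier_integer_mod_group)

lemma in_integer_mod_group_mod: "n > 0 \<Longrightarrow> x \<in> carrier (integer_mod_group n) \<Longrightarrow> x mod int n = x"
  by (simp add: carrier_integer_mod_group)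

lemma circ_cong:
  fixes x y n w :: int
  shows "(x mod n + y mod n + w * (x mod n) * (y mod n)) mod n = (x + y + w * x * y) mod n"
proof -
  have "[x mod n + y mod n + w * (x mod n) * (y mod n) = x + y + w * x * y] (mod n)"
    by (intro cong_add cong_mult cong_refl) (simp_all add: cong_def)
  then show ?thesis
    by (simp add: cong_def)
qed

lemma circ_group_mod:
  fixes x y :: int
  shows "(x mod int n) \<otimes>\<^bsub>circ_group n w\<^esub> (y mod int n) = (x + y + int w * x * y) mod int n"
    and "(x mod int n) \<otimes>\<^bsub>circ_group n w\<^esub> y = (x + y + int w * x * y) mod int n"
    and "x \<otimes>\<^bsub>circ_group n w\<^esub> (y mod int n) = (x + y + int w * x * y) mod int n"
  using circ_cong[of x "int n" y "int w"] circ_cong[of "x mod int n" "int n" y "int w"]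
    circ_cong[of x "int n" "y mod int n" "int w"]
  by simp_all

lemma comm_group_circ_group:
  assumes w: "w \<in> W n" and n: "n > 0"
  shows "comm_group (circ_group n w)"
proof (rule comm_groupI)
  let ?M = "circ_group n w"
  fix x y z
  assume xyz: "x \<in> carrier ?M" "y \<in> carrier ?M" "z \<in> carrier ?M"
  show "x \<otimes>\<^bsub>?M\<^esub> y \<otimes>\<^bsub>?M\<^esub> z = x \<otimes>\<^bsub>?M\<^esub> (y \<otimes>\<^bsub>?M\<^esub> z)"
    unfolding circ_group_simps(3)[of _ _ x y] circ_group_simps(3)[of _ _ y z] circ_group_mod(2,3)
    by (simp add: algebra_simps)
next
  let ?M = "circ_group n w"
  fix x
  assume x: "x \<in> carrier ?M"
  \<comment> \<open>Solving \<open>x + y + w x y = 0\<close> gives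
    \<open>y = - x / (1 + w x)\<close>; \<open>s\<close> inverts the denominator modulo
    \<open>n\<close>.\<close>
  obtain s where "[(1 + int w * x) * s = 1] (mod int n)"
    using mult_W_inverse[OF w n] by blast
  then have "[x + - x * ((1 + int w * x) * s) = x + - x * 1] (mod int n)"
    by (intro cong_add cong_mult cong_refl)
  then have "((- x * s) mod int n) \<otimes>\<^bsub>?M\<^esub> x = \<one>\<^bsub>?M\<^esub>"
    unfolding circ_group_mod(2) by (simp add: cong_def algebra_simps)
  moreover have "(- x * s) mod int n \<in> carrier ?M"
    using mod_in_integer_mod_group[OF n] by simp
  ultimately show "\<exists>y\<in>carrier ?M. y \<otimes>\<^bsub>?M\<^esub> x = \<one>\<^bsub>?M\<^esub>"
    by blast
qed (use n in \<open>auto simp: mod_in_integer_mod_group in_integer_mod_group_mod algebra_simps\<close>)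

text \<open>Composing with 1 sends \<open>a\<close> to \<open>1 + (1 + w) a\<close>, the recursion
  of the geometric sums. The base is \<open>1 mod int n\<close> because 1 is not a representative
  when \<open>n = 1\<close>.\<close>

lemma pow_circ_group:
  "(1 mod int n) [^]\<^bsub>circ_group n w\<^esub> k = (\<Sum>i<k. (1 + int w) ^ i) mod int n"
proof (induction k)
  case (Suc k)
  then show ?case
    unfolding geometric_sum_Suc nat_pow_Suc
    by (simp add: circ_group_mod(1) algebra_simps del: circ_group_simps(3))
qed simp

lemma (in group) cyclic_group_if_ord_eq_order:
  assumes "finite (carrier G)" "a \<in> carrier G" "ord a = order G"
  shows "cyclic_group G"
proof -
  have "generate G {a} = carrier G"
    using assms generate_pow_card[of a] generate_incl[of "{a}"]
    by (intro card_subset_eq) (auto simp: order_def)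
  then have "carrier G = range (\<lambda>k::int. a [^] k)"
    using generate_pow[OF assms(2)] by (simp add: full_SetCompr_eq)
  then show ?thesis
    using assms(2) cyclic_group by blast
qed

lemma card_integer_mod_group: "n > 0 \<Longrightarrow> card (carrier (integer_mod_group n)) = n"
  by (simp add: carrier_integer_mod_group)

lemma finite_integer_mod_group: "n > 0 \<Longrightarrow> finite (carrier (integer_mod_group n))"
  by (simp add: carrier_integer_mod_group)

lemma cyclic_group_integer_mod_group:
  assumes n: "n > 0"
  shows "cyclic_group (integer_mod_group n)"
proof -
  let ?A = "integer_mod_group n"
  have "range (\<lambda>k::int. k mod int n) = carrier ?A"
    using mod_in_integer_mod_group[OF n] in_integer_mod_group_mod[OF n] by (auto simp: image_iff) metis
  then have "carrier ?A = range (\<lambda>k::int. (1 mod int n) [^]\<^bsub>?A\<^esub> k)"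
    by (simp add: int_pow_integer_mod_group mod_simps)
  then show ?thesis
    using group.cyclic_group[OF group_integer_mod_group] mod_in_integer_mod_group[OF n] by blast
qed

text \<open>The order of 1 divides \<open>n\<close> by Lagrange, and \<open>n\<close> divides it by
  the criterion for geometric sums.\<close>

lemma cyclic_group_circ_group:
  assumes w: "w \<in> W n" and n: "n > 0"
  shows "cyclic_group (circ_group n w)"
proof -
  let ?M = "circ_group n w" and ?a = "1 mod int n"
  interpret M: comm_group ?M
    using assms by (rule comm_group_circ_group)
  have a: "?a \<in> carrier ?M"
    using mod_in_integer_mod_group[OF n] by simp
  have fin: "finite (carrier ?M)"
    using finite_integer_mod_group[OF n] by simp
  have order: "order ?M = n"
    using card_integer_mod_group[OF n] by (simp add: order_def)
  have "?a [^]\<^bsub>?M\<^esub> M.ord ?a = \<one>\<^bsub>?M\<^esub>"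
    using a M.pow_ord_eq_1 by blast
  then have "n dvd M.ord ?a"
    unfolding pow_circ_group using dvd_geometric_sum_imp_dvd[OF w n]
    by (simp add: mod_eq_0_iff_dvd)
  moreover have "M.ord ?a dvd n"
    using M.ord_dvd_group_order[OF a] order by simp
  ultimately show ?thesis
    using M.cyclic_group_if_ord_eq_order[OF fin a] order by (simp add: dvd_antisym)
qed

lemma skew_brace_circ_group:
  assumes w: "w \<in> W n" and n: "n > 0"
  shows "skew_brace (integer_mod_group n) (circ_group n w)"
proof -
  have "skew_brace_axioms (integer_mod_group n) (circ_group n w)"
  proof
    let ?A = "integer_mod_group n" and ?M = "circ_group n w"
    fix x y z
    assume xyz: "x \<in> carrier ?A" "y \<in> carrier ?A" "z \<in> carrier ?A"
    show "x \<otimes>\<^bsub>?M\<^esub> (y \<otimes>\<^bsub>?A\<^esub> z) = (x \<otimes>\<^bsub>?M\<^esub> y) \<otimes>\<^bsub>?A\<^esub> inv\<^bsub>?A\<^esub> x \<otimes>\<^bsub>?A\<^esub> (x \<otimes>\<^bsub>?M\<^esub> z)"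
      unfolding mult_integer_mod_group circ_group_mod(3)
      using xyz by (simp add: mod_simps) (simp add: algebra_simps)
  qed simp
  then show ?thesis
    using comm_group_circ_group[OF assms] by (simp add: skew_brace_def comm_group_def)
qed

lemma bicyclic_brace_circ_group:
  assumes "w \<in> W n" "n > 0"
  shows "bicyclic_brace (integer_mod_group n) (circ_group n w)"
  using assms unfolding bicyclic_brace_def brace_def
  by (simp add: skew_brace_circ_group finite_integer_mod_group cyclic_group_integer_mod_group
      cyclic_group_circ_group)

text \<open>With \<open>x'\<close> the circle inverse of \<open>x\<close>, \<open>b\<close> is the
  composite of \<open>x + y\<close> and \<open>x'\<close>, and the second factor on the left is the
  defect of the brace law with the operations exchanged. Multiplying by \<open>1 + w x\<close>
  clears the denominator of \<open>x'\<close>; the first product on the right then vanishes modulo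
  \<open>n\<close>.\<close>

lemma circ_biskew_identity:
  fixes w x x' y z :: int
  defines "a \<equiv> x + y" and "c \<equiv> x + z"
  defines "b \<equiv> a + x' + w * a * x'"
  shows "(1 + w * x) * (b + c + w * b * c - (x + (y + z + w * y * z))) =
    (x + x' + w * x * x') * (1 + w * a) * (1 + w * c) - w\<^sup>2 * x * y * z"
  unfolding a_def b_def c_def by (simp add: algebra_simps power2_eq_square)

lemma biskew_circ_group_iff:
  assumes w: "w \<in> W n" and n: "n > 0"
  shows "biskew (integer_mod_group n) (circ_group n w) \<longleftrightarrow> n dvd w\<^sup>2"
proof -
  let ?A = "integer_mod_group n" and ?M = "circ_group n w"
  interpret M: comm_group ?M
    using assms by (rule comm_group_circ_group)
  have dist: "x \<otimes>\<^bsub>?A\<^esub> (y \<otimes>\<^bsub>?M\<^esub> z) = (x \<otimes>\<^bsub>?A\<^esub> y) \<otimes>\<^bsub>?M\<^esub> inv\<^bsub>?M\<^esub> x \<otimes>\<^bsub>?M\<^esub> (x \<otimes>\<^bsub>?A\<^esub> z)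
      \<longleftrightarrow> int n dvd (int w)\<^sup>2 * x * y * z"
    if x: "x \<in> carrier ?M" for x y z
  proof -
    define x' where "x' = inv\<^bsub>?M\<^esub> x"
    have "x \<otimes>\<^bsub>?M\<^esub> x' = \<one>\<^bsub>?M\<^esub>"
      using x by (simp only: x'_def M.r_inv)
    then have x': "int n dvd x + x' + int w * x * x'"
      by (simp add: mod_eq_0_iff_dvd)
    define b where "b = (x + y) + x' + int w * (x + y) * x'"
    define d where "d = b + (x + z) + int w * b * (x + z) - (x + (y + z + int w * y * z))"
    have R: "(x \<otimes>\<^bsub>?A\<^esub> y) \<otimes>\<^bsub>?M\<^esub> x' \<otimes>\<^bsub>?M\<^esub> (x \<otimes>\<^bsub>?A\<^esub> z) = (b + (x + z) + int w * b * (x + z)) mod int n"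
      by (simp only: mult_integer_mod_group circ_group_mod(2)[where x = "x + y" and y = x'] circ_group_mod(1) b_def)
    have L: "x \<otimes>\<^bsub>?A\<^esub> (y \<otimes>\<^bsub>?M\<^esub> z) = (x + (y + z + int w * y * z)) mod int n"
      by (simp add: mod_simps)
    have "(p mod int n = q mod int n) \<longleftrightarrow> int n dvd q - p" for p q
      by (metis dvd_diff_commute mod_eq_dvd_iff)
    then have "?thesis \<longleftrightarrow> (int n dvd d \<longleftrightarrow> int n dvd (int w)\<^sup>2 * x * y * z)"
      unfolding x'_def[symmetric] L R d_def by simp
    \<comment> \<open>\<open>1 + w x\<close> is a unit modulo \<open>n\<close>, so the defect may be
      multiplied by it.\<close>
    also have "int n dvd d \<longleftrightarrow> int n dvd (1 + int w * x) * d"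
      using coprime_one_plus_mult_W[OF w n] by (simp add: coprime_dvd_mult_right_iff coprime_commute)
    also have "(1 + int w * x) * d = (x + x' + int w * x * x') * (1 + int w * (x + y)) * (1 + int w * (x + z))
        - (int w)\<^sup>2 * x * y * z"
      unfolding d_def b_def by (rule circ_biskew_identity)
    also have "int n dvd \<dots> \<longleftrightarrow> int n dvd (int w)\<^sup>2 * x * y * z"
      using x' by (simp add: dvd_diff_right_iff)
    finally show ?thesis by simp
  qed
  show ?thesis
  proof
    assume "biskew ?A ?M"
    then interpret B: skew_brace ?M ?A
      by (simp add: biskew_def)
    \<comment> \<open>The law is evaluated at \<open>x = y = z = 1\<close>, which requires 1 to be a
      representative, that is \<open>n > 1\<close>.\<close>
    show "n dvd w\<^sup>2"
    proof (cases "n = 1")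
      case False
      then have "1 \<in> carrier ?M"
        by simp
      then have "int n dvd (int w)\<^sup>2 * 1 * 1 * 1"
        using B.brace_distrib dist by blast
      then show ?thesis
        by (metis mult_1_right of_nat_dvd_iff of_nat_power)
    qed simp
  next
    assume "n dvd w\<^sup>2"
    then have "int n dvd (int w)\<^sup>2"
      by (metis of_nat_dvd_iff of_nat_power)
    then have "skew_brace_axioms ?M ?A"
      using dist by unfold_locales (simp_all add: dvd_mult2 del: circ_group_simps(3) mult_integer_mod_group)
    then show "biskew ?A ?M"
      using skew_brace_circ_group[OF w n] M.is_group by (simp add: biskew_def skew_brace_def)
  qed
qed

section \<open>Normal form of a bicyclic brace\<close>

lemma (in group) ord_eq_order_if_generator:
  assumes "finite (carrier G)" "a \<in> carrier G" "carrier G = range (\<lambda>i::int. a [^] i)"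
  shows "ord a = order G"
  using assms generate_pow_card[of a] generate_pow[of a] by (simp add: order_def full_SetCompr_eq)

lemma (in group) carrier_eq_nat_powers:
  assumes "finite (carrier G)" "a \<in> carrier G" "carrier G = range (\<lambda>i::int. a [^] i)"
  shows "carrier G = range (\<lambda>k::nat. a [^] k)"
  using assms generate_pow_on_finite_carrier[of a] generate_pow[of a] by (simp add: full_SetCompr_eq)

section \<open>The lambda maps of a skew brace\<close>

context skew_brace
begin

text \<open>For the multiplicative unit \<open>e\<close>, the brace law at \<open>x = e\<close> and
  \<open>y = z = 0\<close> reads \<open>0 = - e\<close>.\<close>

lemma one_eq: "\<one>\<^bsub>M\<^esub> = \<one>\<^bsub>A\<^esub>"
proof -
  have "\<one>\<^bsub>M\<^esub> \<in> carrier A"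
    using carrier_eq by auto
  then have "\<one>\<^bsub>A\<^esub> = inv\<^bsub>A\<^esub> \<one>\<^bsub>M\<^esub>"
    using brace_distrib[of "\<one>\<^bsub>M\<^esub>" "\<one>\<^bsub>A\<^esub>" "\<one>\<^bsub>A\<^esub>"] carrier_eq by simp
  then show ?thesis
    using \<open>\<one>\<^bsub>M\<^esub> \<in> carrier A\<close> by (metis additive.inv_inv additive.inv_one)
qed

lemma mult_closed_additive: "x \<in> carrier A \<Longrightarrow> y \<in> carrier A \<Longrightarrow> x \<otimes>\<^bsub>M\<^esub> y \<in> carrier A"
  using multiplicative.m_closed carrier_eq by auto

text \<open>This is the usual lambda map of \<open>x\<close>; the brace law is its
  additivity.\<close>

lemma lambda_hom:
  assumes "x \<in> carrier A"
  shows "(\<lambda>y. inv\<^bsub>A\<^esub> x \<otimes>\<^bsub>A\<^esub> (x \<otimes>\<^bsub>M\<^esub> y)) \<in> hom A A"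
  using assms by (intro homI) (simp_all add: mult_closed_additive brace_distrib additive.m_assoc)

lemma mult_additive_int_pow:
  assumes "x \<in> carrier A" "y \<in> carrier A"
  shows "x \<otimes>\<^bsub>M\<^esub> (y [^]\<^bsub>A\<^esub> (i::int)) = x \<otimes>\<^bsub>A\<^esub> (inv\<^bsub>A\<^esub> x \<otimes>\<^bsub>A\<^esub> (x \<otimes>\<^bsub>M\<^esub> y)) [^]\<^bsub>A\<^esub> i"
proof -
  have "inv\<^bsub>A\<^esub> x \<otimes>\<^bsub>A\<^esub> (x \<otimes>\<^bsub>M\<^esub> (y [^]\<^bsub>A\<^esub> i)) = (inv\<^bsub>A\<^esub> x \<otimes>\<^bsub>A\<^esub> (x \<otimes>\<^bsub>M\<^esub> y)) [^]\<^bsub>A\<^esub> i"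
    using hom_int_pow[OF lambda_hom[OF assms(1)] assms(2)] additive.is_group by simp
  then show ?thesis
    using assms by (metis additive.inv_solve_left' additive.int_pow_closed additive.m_closed
        additive.inv_closed mult_closed_additive)
qed

end

section \<open>Coordinates in a bicyclic brace\<close>

lemma bicyclic_brace_common_generator:
  assumes "bicyclic_brace A M"
  obtains c and v :: int where "c \<in> carrier A" "carrier M = range (\<lambda>k::nat. c [^]\<^bsub>M\<^esub> k)"
    "group.ord A c = card (carrier A)"
    "\<And>i j. (c [^]\<^bsub>A\<^esub> i) \<otimes>\<^bsub>M\<^esub> (c [^]\<^bsub>A\<^esub> j) = c [^]\<^bsub>A\<^esub> (i + j + v * i * j)"
proof -
  interpret skew_brace A M
    using assms by (simp add: bicyclic_brace_def brace_def)
  interpret A: comm_group A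
    using assms by (simp add: bicyclic_brace_def brace_def)
  have fin: "finite (carrier A)"
    using assms by (simp add: bicyclic_brace_def)
  obtain g where g: "g \<in> carrier A" "carrier A = range (\<lambda>i::int. g [^]\<^bsub>A\<^esub> i)"
    using assms additive.cyclic_group by (auto simp: bicyclic_brace_def)
  have g_pow: "\<exists>i::int. y = g [^]\<^bsub>A\<^esub> i" if "y \<in> carrier A" for y
    using equalityD1[OF g(2)] that by (metis imageE subsetD)
  obtain c where c: "c \<in> carrier M" "carrier M = range (\<lambda>i::int. c [^]\<^bsub>M\<^esub> i)"
    using assms multiplicative.cyclic_group by (auto simp: bicyclic_brace_def)
  then have cA: "c \<in> carrier A"
    using carrier_eq by simp
  have M: "carrier M = range (\<lambda>k::nat. c [^]\<^bsub>M\<^esub> k)"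
    using fin c by (intro multiplicative.carrier_eq_nat_powers) (simp_all add: carrier_eq)
  have "inv\<^bsub>A\<^esub> c \<otimes>\<^bsub>A\<^esub> (c \<otimes>\<^bsub>M\<^esub> g) \<in> carrier A"
    using cA g(1) by (simp add: mult_closed_additive)
  \<comment> \<open>The image of the additive generator \<open>g\<close> determines the lambda map
    of \<open>c\<close>, which is therefore multiplication by \<open>u\<close> everywhere.\<close>
  then obtain u where u: "inv\<^bsub>A\<^esub> c \<otimes>\<^bsub>A\<^esub> (c \<otimes>\<^bsub>M\<^esub> g) = g [^]\<^bsub>A\<^esub> (u::int)"
    using g_pow by blast
  have c_mult: "c \<otimes>\<^bsub>M\<^esub> y = c \<otimes>\<^bsub>A\<^esub> y [^]\<^bsub>A\<^esub> u" if y: "y \<in> carrier A" for y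
  proof -
    obtain i :: int where i: "y = g [^]\<^bsub>A\<^esub> i"
      using g_pow[OF y] by blast
    show ?thesis
      using mult_additive_int_pow[OF cA g(1), of i] g(1) unfolding u i
      by (simp add: additive.int_pow_pow mult.commute)
  qed
  \<comment> \<open>The lambda map of the \<open>k\<close>-th power of \<open>c\<close> is
    multiplication by \<open>u ^ k\<close>.\<close>
  have c_pow_mult: "(c [^]\<^bsub>M\<^esub> k) \<otimes>\<^bsub>M\<^esub> y = c [^]\<^bsub>A\<^esub> (\<Sum>i<k. u ^ i) \<otimes>\<^bsub>A\<^esub> y [^]\<^bsub>A\<^esub> (u ^ k)"
    if "y \<in> carrier A" for k :: nat and y
    using that
  proof (induction k arbitrary: y)
    case 0
    then show ?case
      using carrier_eq by simp
  next
    case (Suc k)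
    then have y: "y \<in> carrier A" "y \<in> carrier M"
      using carrier_eq by simp_all
    have "(c [^]\<^bsub>M\<^esub> Suc k) \<otimes>\<^bsub>M\<^esub> y = (c [^]\<^bsub>M\<^esub> k) \<otimes>\<^bsub>M\<^esub> (c \<otimes>\<^bsub>A\<^esub> y [^]\<^bsub>A\<^esub> u)"
      using y c(1) by (simp add: multiplicative.m_assoc flip: c_mult)
    also have "\<dots> = c [^]\<^bsub>A\<^esub> (\<Sum>i<k. u ^ i) \<otimes>\<^bsub>A\<^esub> (c \<otimes>\<^bsub>A\<^esub> y [^]\<^bsub>A\<^esub> u) [^]\<^bsub>A\<^esub> (u ^ k)"
      using Suc.IH y cA by simp
    also have "\<dots> = c [^]\<^bsub>A\<^esub> (\<Sum>i<Suc k. u ^ i) \<otimes>\<^bsub>A\<^esub> y [^]\<^bsub>A\<^esub> (u ^ Suc k)"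
      using y cA by (simp add: A.int_pow_distrib additive.int_pow_pow additive.int_pow_mult additive.m_assoc)
    finally show ?case .
  qed
  have c_pow: "c [^]\<^bsub>M\<^esub> k = c [^]\<^bsub>A\<^esub> (\<Sum>i<k. u ^ i)" for k :: nat
    using c_pow_mult[of "\<one>\<^bsub>A\<^esub>" k] c(1) cA
    by (simp flip: one_eq) (simp add: one_eq)
  have "carrier A \<subseteq> range (\<lambda>i::int. c [^]\<^bsub>A\<^esub> i)"
    using M c_pow carrier_eq by auto
  then have A: "carrier A = range (\<lambda>i::int. c [^]\<^bsub>A\<^esub> i)"
    using cA by auto
  have mult: "(c [^]\<^bsub>A\<^esub> i) \<otimes>\<^bsub>M\<^esub> (c [^]\<^bsub>A\<^esub> j) = c [^]\<^bsub>A\<^esub> (i + j + (u - 1) * i * j)" for i j :: int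
  proof -
    have "c [^]\<^bsub>A\<^esub> i \<in> carrier M"
      using cA carrier_eq by simp
    then obtain k :: nat where k: "c [^]\<^bsub>A\<^esub> i = c [^]\<^bsub>M\<^esub> k"
      using equalityD1[OF M] by (metis imageE subsetD)
    \<comment> \<open>\<open>S\<close> and \<open>i\<close> may differ as integers but give the same
      multiple of \<open>c\<close>. Since \<open>u ^ k = 1 + (u - 1) S\<close>, the exponent
      \<open>k\<close> can be eliminated in favour of \<open>i\<close>, with
      \<open>v = u - 1\<close>.\<close>
    define S where "S = (\<Sum>i<k. u ^ i)"
    have S: "c [^]\<^bsub>A\<^esub> i = c [^]\<^bsub>A\<^esub> S"
      using k c_pow S_def by simp
    have u_k: "u ^ k = 1 + (u - 1) * S"
      unfolding S_def using power_diff_1_eq[of u k] by simp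
    have "j * u ^ k = j + S * ((u - 1) * j)"
      unfolding u_k by (simp add: algebra_simps)
    then have "(c [^]\<^bsub>A\<^esub> i) \<otimes>\<^bsub>M\<^esub> (c [^]\<^bsub>A\<^esub> j) =
        c [^]\<^bsub>A\<^esub> i \<otimes>\<^bsub>A\<^esub> (c [^]\<^bsub>A\<^esub> j \<otimes>\<^bsub>A\<^esub> (c [^]\<^bsub>A\<^esub> S) [^]\<^bsub>A\<^esub> ((u - 1) * j))"
      using c_pow_mult[of "c [^]\<^bsub>A\<^esub> j" k] cA unfolding k[symmetric] S_def[symmetric] S[symmetric]
      by (simp add: additive.int_pow_pow additive.int_pow_mult S)
    also have "\<dots> = c [^]\<^bsub>A\<^esub> (i + j + (u - 1) * i * j)"
      unfolding S[symmetric] using cA by (simp add: additive.int_pow_pow additive.int_pow_mult additive.m_assoc mult_ac)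
    finally show ?thesis .
  qed
  show thesis
    using that[OF cA M _ mult] additive.ord_eq_order_if_generator[OF fin cA A] by (simp add: order_def)
qed

lemma bicyclic_brace_parameter_conditions:
  assumes brace: "skew_brace A M" and n: "n > 0" and c: "c \<in> carrier A" "group.ord A c = n"
    and M: "carrier M = range (\<lambda>k::nat. c [^]\<^bsub>M\<^esub> k)"
    and mult: "\<And>i j. (c [^]\<^bsub>A\<^esub> i) \<otimes>\<^bsub>M\<^esub> (c [^]\<^bsub>A\<^esub> j) = c [^]\<^bsub>A\<^esub> (i + j + v * i * j :: int)"
  shows "prime p \<Longrightarrow> p dvd n \<Longrightarrow> int p dvd v" and "4 dvd n \<Longrightarrow> 4 dvd v"
proof -
  interpret skew_brace A M by (rule brace)
  have pow_eq: "c [^]\<^bsub>A\<^esub> i = c [^]\<^bsub>A\<^esub> j \<longleftrightarrow> int n dvd j - i" for i j :: int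
    using additive.int_pow_eq[OF c(1)] c(2) by simp
  have pow_M: "c [^]\<^bsub>A\<^esub> i \<in> carrier M" for i :: int
    using c(1) carrier_eq by simp
  show prime_dvd: "int p dvd v" if p: "prime p" "p dvd n" for p
  proof (rule ccontr)
    assume "\<not> int p dvd v"
    then have "coprime v (int p)"
      using p(1) prime_imp_coprime[of "int p" v] by (simp add: coprime_commute)
    \<comment> \<open>For a root \<open>x\<close> of \<open>1 + v x\<close> modulo \<open>p\<close>
      and \<open>m = n / p\<close>, composing \<open>x\<close> with \<open>m\<close> gives
      \<open>x + m (1 + v x)\<close>, which is \<open>x\<close> modulo \<open>n\<close>. As
      \<open>m\<close> is not 0 modulo \<open>n\<close>, this violates left cancellation.\<close>
    then obtain x where "[v * x = - 1] (mod int p)"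
      by (metis cong_solve_coprime_int cong_scalar_right mult.assoc mult_minus1_right mult.left_neutral)
    then have x: "int p dvd 1 + v * x"
      by (simp add: cong_iff_dvd_diff add.commute)
    obtain m where m: "n = p * m"
      using p(2) by blast
    have eq: "x + 0 + v * x * 0 - (x + int m + v * x * int m) = - ((1 + v * x) * int m)"
      by (simp add: algebra_simps)
    have "int n dvd (1 + v * x) * int m"
      using x m by (simp add: mult_dvd_mono)
    then have "(c [^]\<^bsub>A\<^esub> x) \<otimes>\<^bsub>M\<^esub> (c [^]\<^bsub>A\<^esub> int m) = (c [^]\<^bsub>A\<^esub> x) \<otimes>\<^bsub>M\<^esub> (c [^]\<^bsub>A\<^esub> (0::int))"
      unfolding mult pow_eq eq by (simp only: dvd_minus_iff)
    then have "c [^]\<^bsub>A\<^esub> int m = c [^]\<^bsub>A\<^esub> (0::int)"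
      using pow_M multiplicative.Units_l_cancel multiplicative.Units_eq by blast
    then have "n dvd m"
      unfolding pow_eq by simp
    then show False
      using m n p(1) by (auto dest: dvd_imp_le simp: prime_gt_1_nat)
  qed
  show "4 dvd v" if n4: "4 dvd n"
  proof (rule ccontr)
    assume "\<not> 4 dvd v"
    moreover have "2 dvd v"
      using prime_dvd[of 2] n4 by (simp add: dvd_trans[of 2 4])
    ultimately have v: "v mod 4 = 2"
      by presburger
    \<comment> \<open>Composing with \<open>c\<close> sends the coordinate \<open>m\<close> to
      \<open>m + 1 + v m\<close>, which for \<open>v = 2\<close> modulo 4 exchanges the residues 0
      and 1. The coordinate 2 is never reached.\<close>
    have powers: "\<exists>m::int. c [^]\<^bsub>M\<^esub> k = c [^]\<^bsub>A\<^esub> m \<and> (m mod 4 = 0 \<or> m mod 4 = 1)" for k :: nat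
    proof (induction k)
      case 0
      show ?case
        by (rule exI[of _ 0]) (simp add: one_eq)
    next
      case (Suc k)
      then obtain m :: int where m: "c [^]\<^bsub>M\<^esub> k = c [^]\<^bsub>A\<^esub> m" "m mod 4 = 0 \<or> m mod 4 = 1"
        by metis
      have step: "c [^]\<^bsub>M\<^esub> Suc k = c [^]\<^bsub>A\<^esub> (m + 1 + v * m * 1)"
        using m(1) mult[of m 1] c(1) by (simp add: additive.int_pow_1)
      have "[m + 1 + v * m * 1 = m mod 4 + 1 + (v mod 4) * (m mod 4) * 1] (mod 4)"
        by (intro cong_add cong_mult cong_refl) (simp_all add: cong_def)
      then have "(m + 1 + v * m * 1) mod 4 = 0 \<or> (m + 1 + v * m * 1) mod 4 = 1"
        using m(2) v by (auto simp: cong_def)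
      then show ?case
        unfolding step by (intro exI[of _ "m + 1 + v * m * 1"] conjI refl)
    qed
    obtain m :: int where "c [^]\<^bsub>A\<^esub> (2::int) = c [^]\<^bsub>A\<^esub> m" "m mod 4 = 0 \<or> m mod 4 = 1"
      using pow_M[of 2] equalityD1[OF M] powers by (metis imageE subsetD)
    moreover have "4 dvd int n"
      using n4 by presburger
    ultimately have "4 dvd m - 2" "m mod 4 = 0 \<or> m mod 4 = 1"
      unfolding pow_eq using dvd_trans by blast+
    then show False
      by presburger
  qed
qed

text \<open>In the coordinate \<open>i \<mapsto> s i c\<close> the product of \<open>i\<close> and
  \<open>j\<close> becomes \<open>i + j + v s i j\<close>, and the unit \<open>s\<close> is chosen
  so that \<open>v s\<close> is \<open>w = gcd v n\<close> modulo \<open>n\<close>.\<close>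

lemma bicyclic_brace_isomorphic_circ_group:
  assumes B: "bicyclic_brace A M" and n: "card (carrier A) = n" "n > 0"
  shows "\<exists>w\<in>W n. skew_brace_isomorphic A M (integer_mod_group n) (circ_group n w)"
proof -
  interpret skew_brace A M
    using B by (simp add: bicyclic_brace_def brace_def)
  obtain c v where c: "c \<in> carrier A" "carrier M = range (\<lambda>k::nat. c [^]\<^bsub>M\<^esub> k)"
    "group.ord A c = card (carrier A)"
    and mult: "\<And>i j. (c [^]\<^bsub>A\<^esub> i) \<otimes>\<^bsub>M\<^esub> (c [^]\<^bsub>A\<^esub> j) = c [^]\<^bsub>A\<^esub> (i + j + v * i * j :: int)"
    using bicyclic_brace_common_generator[OF B] by metis
  have ord: "additive.ord c = n"
    using c(3) n(1) by simp
  note v = bicyclic_brace_parameter_conditions[OF skew_brace_axioms n(2) c(1) ord c(2) mult]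
  define w where "w = nat (gcd v (int n))"
  have w: "int w = gcd v (int n)"
    by (simp add: w_def)
  have w_dvd: "d dvd w \<longleftrightarrow> int d dvd v \<and> d dvd n" for d
    using w by (metis gcd_greatest_iff of_nat_dvd_iff)
  have "w \<in> W n"
    using v w_dvd[of w] w_dvd[of 4] by (auto simp: W_def w_dvd)
  obtain s where s: "coprime s (int n)" "[v * s = int w] (mod int n)"
    using unit_multiple_eq_gcd[OF n(2), of v] w by metis
  define f where "f i = c [^]\<^bsub>A\<^esub> (s * i)" for i :: int
  have f_eq: "f i = f j \<longleftrightarrow> [i = j] (mod int n)" for i j
  proof -
    have "f i = f j \<longleftrightarrow> int n dvd s * (j - i)"
      using additive.int_pow_eq[OF c(1)] ord by (simp add: f_def algebra_simps)
    also have "\<dots> \<longleftrightarrow> int n dvd j - i"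
      using s(1) by (simp add: coprime_dvd_mult_right_iff coprime_commute)
    finally show ?thesis
      by (simp add: cong_iff_dvd_diff dvd_diff_commute)
  qed
  let ?Z = "integer_mod_group n" and ?C = "circ_group n w"
  have "inj_on f (carrier ?Z)"
    using n(2) by (auto simp: inj_on_def f_eq cong_def in_integer_mod_group_mod)
  moreover have "f ` carrier ?Z = carrier A"
  proof (rule card_subset_eq)
    show "finite (carrier A)"
      using B by (simp add: bicyclic_brace_def)
    show "f ` carrier ?Z \<subseteq> carrier A"
      using c(1) by (auto simp: f_def)
    show "card (f ` carrier ?Z) = card (carrier A)"
      using \<open>inj_on f (carrier ?Z)\<close> n by (simp add: card_image card_integer_mod_group)
  qed
  ultimately have bij: "bij_betw f (carrier ?Z) (carrier A)"
    by (simp add: bij_betw_def)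
  have "f (i \<otimes>\<^bsub>?Z\<^esub> j) = f i \<otimes>\<^bsub>A\<^esub> f j" for i j
  proof -
    have "f (i \<otimes>\<^bsub>?Z\<^esub> j) = f (i + j)"
      by (simp add: f_eq cong_def)
    then show ?thesis
      using c(1) by (simp add: f_def additive.int_pow_mult distrib_left)
  qed
  then have A: "f \<in> iso ?Z A"
    using bij by (auto simp: iso_def hom_def bij_betw_def)
  have "f (i \<otimes>\<^bsub>?C\<^esub> j) = f i \<otimes>\<^bsub>M\<^esub> f j" for i j
  proof -
    have "[i + j + int w * i * j = i + j + (v * s) * i * j] (mod int n)"
      using s(2) by (intro cong_add cong_mult cong_refl) (rule cong_sym)
    then have "f (i \<otimes>\<^bsub>?C\<^esub> j) = f (i + j + (v * s) * i * j)"
      by (simp add: f_eq cong_def)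
    also have "\<dots> = f i \<otimes>\<^bsub>M\<^esub> f j"
      unfolding f_def mult by (simp add: algebra_simps)
    finally show ?thesis .
  qed
  then have M: "f \<in> iso ?C M"
    using bij carrier_eq by (auto simp: iso_def hom_def bij_betw_def)
  have "inv_into (carrier ?Z) f \<in> iso A ?Z"
    using group.iso_set_sym[OF group_integer_mod_group A] .
  moreover have "inv_into (carrier ?Z) f \<in> iso M ?C"
    using group.iso_set_sym[OF _ M] comm_group_circ_group[OF \<open>w \<in> W n\<close> n(2)] by (simp add: comm_group_def)
  ultimately show ?thesis
    using \<open>w \<in> W n\<close> by (auto simp: skew_brace_isomorphic_def)
qed

section \<open>Uniqueness of the parameter\<close>

lemma skew_brace_isomorphic_sym:
  assumes "group A" "group M" "carrier M = carrier A" "skew_brace_isomorphic A M A' M'"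
  shows "skew_brace_isomorphic A' M' A M"
  using assms group.iso_set_sym[of A _ A'] group.iso_set_sym[of M _ M']
  unfolding skew_brace_isomorphic_def by metis

lemma skew_brace_isomorphic_trans:
  assumes "skew_brace_isomorphic A M A' M'" "skew_brace_isomorphic A' M' A'' M''"
  shows "skew_brace_isomorphic A M A'' M''"
proof -
  obtain f g where "f \<in> iso A A'" "f \<in> iso M M'" "g \<in> iso A' A''" "g \<in> iso M' M''"
    using assms unfolding skew_brace_isomorphic_def by blast
  then have "g \<circ> f \<in> iso A A''" "g \<circ> f \<in> iso M M''"
    using iso_set_trans by metis+
  then show ?thesis
    unfolding skew_brace_isomorphic_def by blast
qed

text \<open>An isomorphism is multiplication by a unit \<open>t\<close>; comparing the images of \<open>1 \<circ> 1\<close> yields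
  \<open>t w = w' t\<^sup>2\<close> modulo \<open>n\<close>.\<close>

lemma dvd_if_circ_groups_isomorphic:
  assumes w: "w \<in> W n" and w': "w' \<in> W n" and n: "n > 0"
    and iso: "skew_brace_isomorphic (integer_mod_group n) (circ_group n w)
      (integer_mod_group n) (circ_group n w')"
  shows "w' dvd w"
proof (cases "n = 1")
  case True
  then show ?thesis
    using w' by (simp add: W_def)
next
  case False
  let ?Z = "integer_mod_group n"
  obtain h where h: "h \<in> iso ?Z ?Z" "h \<in> iso (circ_group n w) (circ_group n w')"
    using iso by (auto simp: skew_brace_isomorphic_def)
  have one: "1 \<in> carrier ?Z"
    using False by simp
  define t where "t = h 1"
  have h_mod: "h (k mod int n) = (k * t) mod int n" for k
    using hom_int_pow[of h ?Z ?Z 1 k] h(1) one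
    by (simp add: iso_def int_pow_integer_mod_group t_def)
  \<comment> \<open>The preimage of 1 is an inverse of \<open>t\<close> modulo
    \<open>n\<close>.\<close>
  obtain x where x: "x \<in> carrier ?Z" "h x = 1"
    using h(1) one by (metis Group.iso_iff imageE)
  then have "(x * t) mod int n = 1"
    using h_mod[of x] in_integer_mod_group_mod[OF n] by simp
  then have xt: "[x * t = 1] (mod int n)"
    using False n by (simp add: cong_def)
  have "h (1 \<otimes>\<^bsub>circ_group n w\<^esub> 1) = h 1 \<otimes>\<^bsub>circ_group n w'\<^esub> h 1"
    using hom_mult[of h "circ_group n w" "circ_group n w'" 1 1] h(2) one
    by (simp add: iso_def del: circ_group_simps(3))
  then have "[(2 + int w) * t = t + t + int w' * t * t] (mod int n)"
    using h_mod[of "2 + int w"] by (simp add: t_def cong_def)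
  then have "int n dvd (int w - int w' * t) * t"
    by (simp add: cong_iff_dvd_diff algebra_simps)
  moreover have "coprime t (int n)"
    using xt by (metis coprime_iff_invertible_int mult.commute)
  ultimately have "int n dvd int w - int w' * t"
    by (simp add: coprime_dvd_mult_left_iff coprime_commute)
  \<comment> \<open>Modulo \<open>w'\<close>, which divides \<open>n\<close>, the congruence
    \<open>w = w' t\<close> leaves \<open>w = 0\<close>.\<close>
  moreover have "int w' dvd int n"
    using w' by (simp add: W_def)
  ultimately have "int w' dvd int w - int w' * t"
    using dvd_trans by blast
  then have "int w' dvd int w"
    by (simp add: dvd_diff_left_iff)
  then show ?thesis
    by simp
qed

theorem theorem1p1:
  fixes n :: nat
  assumes "n > 0"
  shows "(\<forall>w \<in> W n. bicyclic_brace (integer_mod_group n) (circ_group n w)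
            \<and> card (carrier (integer_mod_group n)) = n)
    \<and> (\<forall>(A :: 'a monoid) (M :: 'a monoid). bicyclic_brace A M \<and> card (carrier A) = n \<longrightarrow>
          (\<exists>!w. w \<in> W n \<and> skew_brace_isomorphic A M (integer_mod_group n) (circ_group n w)))
    \<and> (\<forall>w \<in> W n. biskew (integer_mod_group n) (circ_group n w) \<longleftrightarrow> n dvd w\<^sup>2)"
proof (intro conjI ballI allI impI)
  fix A M :: "'a monoid"
  assume B: "bicyclic_brace A M \<and> card (carrier A) = n"
  then interpret skew_brace A M
    by (simp add: bicyclic_brace_def brace_def)
  let ?iso = "\<lambda>w. skew_brace_isomorphic A M (integer_mod_group n) (circ_group n w)"
  \<comment> \<open>Two parameters of one brace give isomorphic standard braces, so each divides the
    other.\<close>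
  have dvd: "w' dvd w" if "w \<in> W n" "w' \<in> W n" "?iso w" "?iso w'" for w w'
    using dvd_if_circ_groups_isomorphic[OF that(1,2) assms]
      skew_brace_isomorphic_trans[OF skew_brace_isomorphic_sym[OF _ _ carrier_eq that(3)] that(4)]
      additive.is_group multiplicative.is_group by blast
  obtain w where "w \<in> W n" "?iso w"
    using bicyclic_brace_isomorphic_circ_group B assms by blast
  then show "\<exists>!w. w \<in> W n \<and> ?iso w"
    using dvd dvd_antisym by blast
qed (use assms bicyclic_brace_circ_group card_integer_mod_group biskew_circ_group_iff in auto)

end
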